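(* Let $\delta>0$ be a constant and $p=1/2$. Then asymptotically almost surely (i.e. with probability tending to $1$ as $n\to\infty$) the random graph $G(n,1/2)$ satisfies $$w(G(n,1/2)) \le (1+\delta)\log_2 n + 1 .$$
   Context: $G(n,p)$ is the random graph on $n$ labeled vertices in which each of the $\binom n2$ possible edges is present independently with probability $p$. All graphs are simple. A graph homomorphism $\phi:G\to H$ is a map $V(G)\to V(H)$ sending edges to edges; $\mathrm{Hom}(G,H)$ denotes the set of homomorphisms. For $d\ge 0$, $T^d$ is the infinite rooted tree in which the root has $d$ children and every other vertex also has exactly $d$ children. A map $\varphi\in\mathrm{Hom}(T^d,G)$ is called cold if there is a vertex $a$ of $G$ such that for every $k$ there is no $\psi\in\mathrm{Hom}(T^d,G)$ that agrees with $\varphi$ on all vertices at distance $k$ from the root $r$ and has $\psi(r)=a$. A graph $G$ is $d$-warm if $\mathrm{Hom}(T^{d-2},G)$ contains no cold maps, and the warmth $w(G)$ is the largest $d$ for which $G$ is $d$-warm. *)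

theory Defs
  imports "HOL-Probability.Probability" "HOL-Library.Extended_Nat"
begin

text \<open>A simple graph is a pair of a vertex set and a set of two-element sets of vertices.\<close>

type_synonym 'a graph = "'a set \<times> 'a set set"

abbreviation verts :: "'a graph \<Rightarrow> 'a set" where "verts G \<equiv> fst G"
abbreviation edges :: "'a graph \<Rightarrow> 'a set set" where "edges G \<equiv> snd G"

text \<open>Since graphs are simple, the image of an edge is an edge only if its endpoints stay distinct.\<close>

definition Hom :: "'a graph \<Rightarrow> 'b graph \<Rightarrow> ('a \<Rightarrow> 'b) set" where
  "Hom G H = {\<phi> \<in> verts G \<rightarrow>\<^sub>E verts H. \<forall>e\<in>edges G. \<phi> ` e \<in> edges H}"

text \<open>
  The vertices of \<open>T\<^sup>d\<close> are the words over \<open>{..<d}\<close>: the root is the empty word, the children of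
  \<open>xs\<close> are the words \<open>i # xs\<close>, and the distance of \<open>xs\<close> from the root is \<open>length xs\<close>.
\<close>

definition tree :: "nat \<Rightarrow> nat list graph" where
  "tree d = (lists {..<d}, {{xs, i # xs} |xs i. xs \<in> lists {..<d} \<and> i < d})"

definition cold :: "nat \<Rightarrow> 'a graph \<Rightarrow> (nat list \<Rightarrow> 'a) \<Rightarrow> bool" where
  "cold d G \<phi> \<longleftrightarrow>
     \<phi> \<in> Hom (tree d) G \<and>
     (\<exists>a\<in>verts G. \<forall>k. \<not> (\<exists>\<psi>\<in>Hom (tree d) G.
        (\<forall>x\<in>verts (tree d). length x = k \<longrightarrow> \<psi> x = \<phi> x) \<and> \<psi> [] = a))"

definition warm :: "nat \<Rightarrow> 'a graph \<Rightarrow> bool" where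
  "warm d G \<longleftrightarrow> 2 \<le> d \<and> \<not> (\<exists>\<phi>\<in>Hom (tree (d - 2)) G. cold (d - 2) G \<phi>)"

text \<open>
  Every graph is 2-warm, so the supremum is the maximum whenever there is one. It is \<open>\<infinity>\<close> if the
  graph is \<open>d\<close>-warm for arbitrarily large \<open>d\<close>; this happens, for instance, for a graph without
  edges, which admits no homomorphism from \<open>T\<^sup>d\<close> for \<open>d \<ge> 1\<close>.
\<close>

definition warmth :: "'a graph \<Rightarrow> enat" where
  "warmth G = (SUP d\<in>{d. warm d G}. enat d)"

definition all_edges :: "nat \<Rightarrow> nat set set" where
  "all_edges n = {e. e \<subseteq> {..<n} \<and> card e = 2}"

definition random_graph :: "nat \<Rightarrow> real \<Rightarrow> nat graph pmf" where
  "random_graph n p =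
     map_pmf (\<lambda>present. ({..<n}, {e \<in> all_edges n. present e}))
       (Pi_pmf (all_edges n) False (\<lambda>_. bernoulli_pmf p))"

end

theory Submission
  imports Defs "HOL-Real_Asymp.Real_Asymp"
begin

text \<open>
  Suppose every vertex \<open>v\<close> has \<open>D\<close> neighbours whose only common neighbour is \<open>v\<close>. Sending the
  children of every tree vertex mapped to \<open>v\<close> to these neighbours gives a homomorphism from
  \<open>T\<^sup>D\<close> whose values on any level determine all values above it, so it is cold.

  Such neighbours are found greedily. Fix \<open>c > 1/2\<close> and suppose that every \<open>u \<noteq> v\<close> is adjacent to
  fewer than a fraction \<open>c\<close> of the neighbours of \<open>v\<close>. By double counting, for any set \<open>C\<close> of
  vertices other than \<open>v\<close> some neighbour of \<open>v\<close> is adjacent to at most \<open>c |C|\<close> elements of \<open>C\<close>, so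
  \<open>D\<close> neighbours suffice once \<open>c\<^sup>D n < 1\<close>. In \<open>G(n, 1/2)\<close> an exponential moment bound shows that
  the hypothesis fails for a given pair with exponentially small probability.
\<close>

section \<open>Cold maps built from a choice of neighbours at every vertex\<close>

definition nbrs :: "'a graph \<Rightarrow> 'a \<Rightarrow> 'a set" where
  "nbrs G v = {w \<in> verts G. {v, w} \<in> edges G}"

primrec walk_map :: "('a \<Rightarrow> nat \<Rightarrow> 'a) \<Rightarrow> 'a \<Rightarrow> nat list \<Rightarrow> 'a" where
  "walk_map w v [] = v"
| "walk_map w v (i # xs) = w (walk_map w v xs) i"

lemma walk_map_in_verts:
  assumes "v \<in> verts G" "xs \<in> lists {..<D}"
    and "\<And>u i. u \<in> verts G \<Longrightarrow> i < D \<Longrightarrow> w u i \<in> nbrs G u"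
  shows "walk_map w v xs \<in> verts G"
  using assms(2) by (induction xs) (use assms(1,3) in \<open>auto simp: nbrs_def\<close>)

lemma walk_map_Hom:
  assumes "v \<in> verts G"
    and w: "\<And>u i. u \<in> verts G \<Longrightarrow> i < D \<Longrightarrow> w u i \<in> nbrs G u"
  shows "restrict (walk_map w v) (lists {..<D}) \<in> Hom (tree D) G"
proof -
  have mem: "walk_map w v xs \<in> verts G" if "xs \<in> lists {..<D}" for xs
    using walk_map_in_verts[OF assms(1) that] w by blast
  have "restrict (walk_map w v) (lists {..<D}) ` {xs, i # xs} \<in> edges G"
    if "xs \<in> lists {..<D}" "i < D" for xs i
    using w[OF mem[OF that(1)] that(2)] that by (simp add: nbrs_def)
  then have "\<forall>e\<in>edges (tree D). restrict (walk_map w v) (lists {..<D}) ` e \<in> edges G"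
    unfolding tree_def snd_conv by blast
  then show ?thesis
    using mem by (simp add: Hom_def tree_def)
qed

text \<open>By \<open>rigid\<close>, the values on the children of a tree vertex leave only one
  possible value at that vertex. Agreement on level \<open>k\<close> therefore spreads up to the
  root and forces the value \<open>v\<close> there, so any other vertex \<open>a\<close> witnesses
  coldness for all \<open>k\<close> at once.\<close>

lemma cold_walk_map:
  assumes "v \<in> verts G" "a \<in> verts G" "a \<noteq> v"
    and w: "\<And>u i. u \<in> verts G \<Longrightarrow> i < D \<Longrightarrow> w u i \<in> nbrs G u"
    and rigid: "\<And>u u'. u \<in> verts G \<Longrightarrow> u' \<in> verts G \<Longrightarrow>
      (\<And>i. i < D \<Longrightarrow> u' \<in> nbrs G (w u i)) \<Longrightarrow> u' = u"
  shows "cold D G (restrict (walk_map w v) (lists {..<D}))"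
proof -
  let ?\<phi> = "restrict (walk_map w v) (lists {..<D})"
  have "\<psi> [] \<noteq> a" if \<psi>: "\<psi> \<in> Hom (tree D) G"
    and agree: "\<And>x. x \<in> lists {..<D} \<Longrightarrow> length x = k \<Longrightarrow> \<psi> x = ?\<phi> x" for \<psi> k
  proof -
    \<comment> \<open>The induction climbs from level \<open>k\<close> to the root; \<open>j\<close>
      is the number of levels between \<open>x\<close> and level \<open>k\<close>.\<close>
    have "\<psi> x = walk_map w v x" if "x \<in> lists {..<D}" "length x + j = k" for x j
      using that
    proof (induction j arbitrary: x)
      case 0
      then show ?case using agree by simp
    next
      case (Suc j)
      have x: "walk_map w v x \<in> verts G"
        using walk_map_in_verts[OF assms(1) Suc.prems(1)] w by blast
      have \<psi>x: "\<psi> x \<in> verts G"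
        using \<psi> Suc.prems(1) by (auto simp: Hom_def tree_def)
      have "\<psi> x \<in> nbrs G (w (walk_map w v x) i)" if "i < D" for i
      proof -
        have "{x, i # x} \<in> edges (tree D)"
          using Suc.prems(1) that unfolding tree_def snd_conv by blast
        then have "\<psi> ` {x, i # x} \<in> edges G"
          using \<psi> unfolding Hom_def by blast
        moreover have "\<psi> (i # x) = w (walk_map w v x) i"
          using Suc.IH[of "i # x"] Suc.prems that by simp
        ultimately show ?thesis
          using \<psi>x by (simp add: nbrs_def insert_commute)
      qed
      then show ?case
        by (rule rigid[OF x \<psi>x])
    qed
    from this[of "[]" k] show ?thesis using assms(3) by simp
  qed
  then have "\<not> (\<exists>\<psi>\<in>Hom (tree D) G.
      (\<forall>x\<in>verts (tree D). length x = k \<longrightarrow> \<psi> x = ?\<phi> x) \<and> \<psi> [] = a)" for k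
    unfolding tree_def fst_conv by blast
  moreover have "?\<phi> \<in> Hom (tree D) G"
    using assms(1) w by (rule walk_map_Hom)
  ultimately show ?thesis
    unfolding cold_def using assms(2) by blast
qed

section \<open>Double counting and the greedy choice of neighbours\<close>

lemma sum_card_nbrs_Int:
  assumes "finite (verts G)" "C \<subseteq> verts G"
  shows "(\<Sum>w\<in>nbrs G v. card (nbrs G w \<inter> C)) = (\<Sum>u\<in>C. card (nbrs G u \<inter> nbrs G v))"
proof -
  have fin: "finite (nbrs G v)" "finite C"
    using assms finite_subset by (auto simp: nbrs_def)
  have "(\<Sum>w\<in>nbrs G v. card (nbrs G w \<inter> C))
      = (\<Sum>w\<in>nbrs G v. \<Sum>u\<in>C. if {w, u} \<in> edges G then 1 else 0)"
  proof (rule sum.cong[OF refl])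
    fix w
    have "nbrs G w \<inter> C = {u \<in> C. {w, u} \<in> edges G}"
      using assms(2) by (auto simp: nbrs_def)
    then show "card (nbrs G w \<inter> C) = (\<Sum>u\<in>C. if {w, u} \<in> edges G then 1 else 0)"
      using fin(2) by (simp add: sum.If_cases Int_def)
  qed
  also have "\<dots> = (\<Sum>u\<in>C. \<Sum>w\<in>nbrs G v. if {w, u} \<in> edges G then 1 else 0)"
    by (rule sum.swap)
  also have "\<dots> = (\<Sum>u\<in>C. card (nbrs G u \<inter> nbrs G v))"
  proof (rule sum.cong[OF refl])
    fix u
    have "nbrs G u \<inter> nbrs G v = {w \<in> nbrs G v. {w, u} \<in> edges G}"
      by (auto simp: nbrs_def insert_commute)
    then show "(\<Sum>w\<in>nbrs G v. if {w, u} \<in> edges G then 1 else 0) = card (nbrs G u \<inter> nbrs G v)"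
      using fin(1) by (simp add: sum.If_cases Int_def)
  qed
  finally show ?thesis .
qed

text \<open>The strict inequality also excludes isolated vertices when there are at least two vertices.\<close>

definition sparse_codegrees :: "real \<Rightarrow> 'a graph \<Rightarrow> bool" where
  "sparse_codegrees c G \<longleftrightarrow>
     (\<forall>u\<in>verts G. \<forall>v\<in>verts G. u \<noteq> v \<longrightarrow>
        real (card (nbrs G u \<inter> nbrs G v)) < c * real (card (nbrs G v)))"

text \<open>An averaging argument: the mean of \<open>card (nbrs G w \<inter> C)\<close> over the
  neighbours \<open>w\<close> of \<open>v\<close> is a sum of codegrees divided by the degree of
  \<open>v\<close>, hence at most \<open>c * card C\<close>.\<close>

lemma exists_contracting_nbr:
  assumes "finite (verts G)" "sparse_codegrees c G" "v \<in> verts G" "C \<subseteq> verts G - {v}"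
    and "nbrs G v \<noteq> {}"
  obtains w where "w \<in> nbrs G v" "real (card (nbrs G w \<inter> C)) \<le> c * real (card C)"
proof (cases "C = {}")
  case True
  then show ?thesis using assms(5) that by auto
next
  case False
  have fin: "finite C" "finite (nbrs G v)"
    using assms finite_subset by (auto simp: nbrs_def)
  have "\<exists>w\<in>nbrs G v. real (card (nbrs G w \<inter> C)) \<le> c * real (card C)"
  proof (rule ccontr)
    assume "\<not> ?thesis"
    then have "(\<Sum>w\<in>nbrs G v. c * real (card C)) \<le> (\<Sum>w\<in>nbrs G v. real (card (nbrs G w \<inter> C)))"
      by (intro sum_mono) force
    also have "\<dots> = (\<Sum>u\<in>C. real (card (nbrs G u \<inter> nbrs G v)))"
      using sum_card_nbrs_Int[of G C v] assms(1,4)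
      by (simp flip: of_nat_sum add: subset_Diff_insert)
    \<comment> \<open>Strictness needs a nonempty \<open>C\<close>, which is why the empty case was
      split off.\<close>
    also have "\<dots> < (\<Sum>u\<in>C. c * real (card (nbrs G v)))"
      using assms(2,3,4) False fin(1)
      by (intro sum_strict_mono) (auto simp: sparse_codegrees_def)
    finally show False by simp
  qed
  then show ?thesis using that by blast
qed

text \<open>Each greedy step shrinks the set of surviving common neighbours by the factor
  \<open>c\<close>. The chosen neighbours may repeat, since a homomorphism may identify
  siblings.\<close>

lemma exists_nbrs_few_common:
  fixes c :: real
  assumes "finite (verts G)" "sparse_codegrees c G" "v \<in> verts G" "nbrs G v \<noteq> {}" "c \<ge> 0"
  shows "\<exists>w. (\<forall>i<k. w i \<in> nbrs G v) \<and>
    real (card {u \<in> verts G - {v}. \<forall>i<k. u \<in> nbrs G (w i)}) \<le> c ^ k * real (card (verts G))"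
proof (induction k)
  case 0
  then show ?case using assms(1) by (auto intro: card_mono)
next
  case (Suc k)
  then obtain w where w: "\<forall>i<k. w i \<in> nbrs G v"
    "real (card {u \<in> verts G - {v}. \<forall>i<k. u \<in> nbrs G (w i)}) \<le> c ^ k * real (card (verts G))"
    (is "real (card ?C) \<le> _")
    by blast
  have "?C \<subseteq> verts G - {v}" by auto
  from exists_contracting_nbr[OF assms(1,2,3) this assms(4)] obtain x where
    x: "x \<in> nbrs G v" "real (card (nbrs G x \<inter> ?C)) \<le> c * real (card ?C)" by blast
  have "{u \<in> verts G - {v}. \<forall>i<Suc k. u \<in> nbrs G ((w(k := x)) i)} = nbrs G x \<inter> ?C"
    by (auto simp: less_Suc_eq)
  moreover have "c * real (card ?C) \<le> c * (c ^ k * real (card (verts G)))"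
    using w(2) assms(5) by (rule mult_left_mono)
  ultimately have "real (card {u \<in> verts G - {v}. \<forall>i<Suc k. u \<in> nbrs G ((w(k := x)) i)})
      \<le> c ^ Suc k * real (card (verts G))"
    using x(2) by (simp add: mult.assoc)
  moreover have "\<forall>i<Suc k. (w(k := x)) i \<in> nbrs G v"
    using w(1) x(1) by (auto simp: less_Suc_eq)
  ultimately show ?case by blast
qed

section \<open>From sparse codegrees to the bound on the warmth\<close>

lemma not_warm_if_sparse_codegrees:
  assumes "finite (verts G)" "card (verts G) \<ge> 2" "sparse_codegrees c G" "c \<ge> 0"
    and small: "c ^ (d - 2) * real (card (verts G)) < 1"
  shows "\<not> warm d G"
proof -
  obtain v a where va: "v \<in> verts G" "a \<in> verts G" "a \<noteq> v"
    using assms(1,2) by (metis card_le_Suc0_iff_eq not_less_eq_eq numeral_2_eq_2)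
  have "\<exists>w. (\<forall>i<d - 2. w i \<in> nbrs G u) \<and>
      (\<forall>u'\<in>verts G. (\<forall>i<d - 2. u' \<in> nbrs G (w i)) \<longrightarrow> u' = u)" if u: "u \<in> verts G" for u
  proof -
    obtain u' where "u' \<in> verts G" "u' \<noteq> u" using va by metis
    then have "real (card (nbrs G u' \<inter> nbrs G u)) < c * real (card (nbrs G u))"
      using assms(3) u by (auto simp: sparse_codegrees_def)
    then have "nbrs G u \<noteq> {}" by auto
    from exists_nbrs_few_common[OF assms(1,3) u this assms(4), of "d - 2"] obtain w where
      w: "\<forall>i<d - 2. w i \<in> nbrs G u"
      "real (card {u' \<in> verts G - {u}. \<forall>i<d - 2. u' \<in> nbrs G (w i)}) < 1"
      using small by fastforce
    \<comment> \<open>A cardinality below 1 vanishes, so only \<open>u\<close> itself can be a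
      common neighbour.\<close>
    then have "card {u' \<in> verts G - {u}. \<forall>i<d - 2. u' \<in> nbrs G (w i)} = 0" by simp
    then have "{u' \<in> verts G - {u}. \<forall>i<d - 2. u' \<in> nbrs G (w i)} = {}"
      using assms(1) by simp
    with w(1) show ?thesis by blast
  qed
  then obtain w where w: "\<And>u i. u \<in> verts G \<Longrightarrow> i < d - 2 \<Longrightarrow> w u i \<in> nbrs G u"
    and rigid: "\<And>u u'. u \<in> verts G \<Longrightarrow> u' \<in> verts G \<Longrightarrow>
      (\<And>i. i < d - 2 \<Longrightarrow> u' \<in> nbrs G (w u i)) \<Longrightarrow> u' = u"
    by metis
  have "cold (d - 2) G (restrict (walk_map w v) (lists {..<d - 2}))"
    using cold_walk_map[where G = G and w = w and D = "d - 2", OF va w rigid] .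
  then show ?thesis
    unfolding warm_def cold_def by blast
qed

text \<open>The base \<open>c\<close> satisfies \<open>log 2 c = - 1 / (1 + \<delta> / 2)\<close>,
  so \<open>c ^ (d - 2) * n < 1\<close> as soon as \<open>d - 2\<close> exceeds
  \<open>(1 + \<delta> / 2) * log 2 n\<close>. The other half of \<delta> is kept to absorb an
  additive constant.\<close>

lemma warmth_le_if_sparse_codegrees:
  fixes \<delta> :: real
  assumes "\<delta> > 0" "finite (verts G)" "card (verts G) \<ge> 2"
    and "sparse_codegrees (2 powr (- 1 / (1 + \<delta> / 2))) G"
    and large: "\<delta> / 2 * log 2 (real (card (verts G))) \<ge> 1"
  shows "ereal_of_enat (warmth G) \<le> ereal ((1 + \<delta>) * log 2 (real (card (verts G))) + 1)"
proof -
  let ?n = "real (card (verts G))" and ?c = "2 powr (- 1 / (1 + \<delta> / 2)) :: real"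
  let ?x = "(1 + \<delta>) * log 2 ?n + 1"
  have "real d \<le> ?x" if "warm d G" for d
  proof -
    have "d \<ge> 2" using that by (simp add: warm_def)
    have n: "?n > 0" using assms(3) by simp
    have "1 \<le> ?c ^ (d - 2) * ?n"
      using not_warm_if_sparse_codegrees[OF assms(2,3,4), of d] that by fastforce
    then have "0 \<le> log 2 (?c ^ (d - 2) * ?n)" by simp
    also have "\<dots> = real (d - 2) * (- 1 / (1 + \<delta> / 2)) + log 2 ?n"
      using n by (simp add: log_mult log_nat_power)
    finally have "real (d - 2) / (1 + \<delta> / 2) \<le> log 2 ?n" by simp
    then have "real (d - 2) \<le> (1 + \<delta> / 2) * log 2 ?n"
      using assms(1) by (simp add: field_simps)
    \<comment> \<open>The bound so far has \<open>+ 2\<close>; \<open>large\<close> trades the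
      excess 1 for \<open>\<delta> / 2 * log 2 n\<close>.\<close>
    then show ?thesis using large \<open>d \<ge> 2\<close> by (simp add: algebra_simps of_nat_diff)
  qed
  moreover have "log 2 ?n \<ge> 0" using assms(3) by simp
  then have "?x \<ge> 0" using assms(1) by simp
  \<comment> \<open>The supremum is taken in \<open>enat\<close>, so the real bound is replaced by
    its floor.\<close>
  ultimately have "d \<le> nat \<lfloor>?x\<rfloor>" if "warm d G" for d
    using that by (simp only: le_nat_floor)
  then have "warmth G \<le> enat (nat \<lfloor>?x\<rfloor>)"
    unfolding warmth_def by (intro SUP_least) simp
  then have "ereal_of_enat (warmth G) \<le> ereal_of_enat (enat (nat \<lfloor>?x\<rfloor>))"
    by (simp only: ereal_of_enat_le_iff)
  also have "\<dots> \<le> ereal ?x"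
    using of_nat_floor[OF \<open>?x \<ge> 0\<close>] by (simp only: ereal_of_enat_simps ereal_less_eq)
  finally show ?thesis .
qed

section \<open>Exponential moments and the probability of a large codegree\<close>

text \<open>The coordinates \<open>e1 w\<close> and \<open>e2 w\<close> are all distinct, so the
  factors are independent and the integral of the product factorises. The induction splits off two
  coordinates at a time.\<close>

lemma nn_integral_Pi_pmf_pairs:
  fixes F :: "'b \<Rightarrow> 'b \<Rightarrow> ennreal"
  assumes "finite W" "finite A" "e1 ` W \<subseteq> A" "e2 ` W \<subseteq> A"
    and "inj_on e1 W" "inj_on e2 W" "e1 ` W \<inter> e2 ` W = {}"
  shows "(\<integral>\<^sup>+y. (\<Prod>w\<in>W. F (y (e1 w)) (y (e2 w))) \<partial>Pi_pmf A dflt (\<lambda>_. p))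
       = (\<integral>\<^sup>+a. \<integral>\<^sup>+b. F a b \<partial>p \<partial>p) ^ card W"
  using assms
proof (induction W arbitrary: A rule: finite_induct)
  case empty
  then show ?case by (simp add: measure_pmf.emeasure_space_1)
next
  case (insert w W)
  define B where "B = A - {e1 w, e2 w}"
  have ne: "e1 w \<noteq> e2 w" using insert.prems by auto
  have A: "A = insert (e1 w) (insert (e2 w) B)" using insert.prems by (auto simp: B_def)
  have B: "finite B" "e1 w \<notin> insert (e2 w) B" "e2 w \<notin> B"
    using insert.prems ne by (auto simp: B_def)
  have off: "e1 w' \<noteq> e1 w" "e1 w' \<noteq> e2 w" "e2 w' \<noteq> e1 w" "e2 w' \<noteq> e2 w" if "w' \<in> W" for w'
  proof -
    have "w' \<noteq> w" using that insert.hyps by blast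
    then show "e1 w' \<noteq> e1 w" "e2 w' \<noteq> e2 w"
      using that inj_onD[OF insert.prems(4), of w' w] inj_onD[OF insert.prems(5), of w' w] by blast+
    show "e1 w' \<noteq> e2 w" "e2 w' \<noteq> e1 w"
      using that imageI[of w' "insert w W" e1] imageI[of w' "insert w W" e2]
        imageI[of w "insert w W" e1] imageI[of w "insert w W" e2] insert.prems(6)
      by (metis IntI empty_iff insertCI)+
  qed
  have IH: "(\<integral>\<^sup>+y. (\<Prod>w\<in>W. F (y (e1 w)) (y (e2 w))) \<partial>Pi_pmf B dflt (\<lambda>_. p))
       = (\<integral>\<^sup>+a. \<integral>\<^sup>+b. F a b \<partial>p \<partial>p) ^ card W"
  proof (rule insert.IH)
    show "e1 ` W \<subseteq> B" "e2 ` W \<subseteq> B"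
      using insert.prems(2,3) off by (simp_all add: B_def image_subset_iff)
    show "e1 ` W \<inter> e2 ` W = {}"
      using insert.prems(6) by (simp add: Int_insert_left Int_insert_right split: if_splits)
    show "inj_on e1 W" "inj_on e2 W"
      using insert.prems(4,5) by (auto elim: inj_on_subset)
  qed (fact B(1))
  have prod: "(\<Prod>v\<in>insert w W. F ((y(e2 w := b, e1 w := a)) (e1 v)) ((y(e2 w := b, e1 w := a)) (e2 v)))
      = F a b * (\<Prod>v\<in>W. F (y (e1 v)) (y (e2 v)))" for y a b
  proof -
    have "(\<Prod>v\<in>W. F ((y(e2 w := b, e1 w := a)) (e1 v)) ((y(e2 w := b, e1 w := a)) (e2 v)))
        = (\<Prod>v\<in>W. F (y (e1 v)) (y (e2 v)))"
      by (rule prod.cong) (simp_all add: off)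
    then show ?thesis using insert.hyps ne by simp
  qed
  have "(\<integral>\<^sup>+y. (\<Prod>w\<in>insert w W. F (y (e1 w)) (y (e2 w))) \<partial>Pi_pmf A dflt (\<lambda>_. p))
      = (\<integral>\<^sup>+a. \<integral>\<^sup>+b. \<integral>\<^sup>+y. F a b * (\<Prod>w\<in>W. F (y (e1 w)) (y (e2 w)))
            \<partial>Pi_pmf B dflt (\<lambda>_. p) \<partial>p \<partial>p)"
    unfolding A
    by (simp only: Pi_pmf_insert[OF finite.insertI[OF B(1)] B(2)] Pi_pmf_insert[OF B(1,3)]
        nn_integral_map_pmf nn_integral_pair_pmf' split_beta fst_conv snd_conv prod)
  also have "\<dots> = (\<integral>\<^sup>+a. \<integral>\<^sup>+b. F a b \<partial>p \<partial>p) ^ card (insert w W)"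
    using insert.hyps by (simp add: nn_integral_cmult nn_integral_multc IH)
  finally show ?case .
qed

text \<open>The left-hand side has value 1 and derivative \<open>(1 - 2 c) / 4 < 0\<close> at \<open>t = 0\<close>.\<close>

lemma exp_average_less_1:
  fixes c :: real
  assumes "c > 1/2"
  obtains t where "t > 0" "(2 + exp (t * (1 - c)) + exp (- (t * c))) / 4 < 1"
proof -
  define f where "f t = exp (t * (1 - c)) + exp (- (t * c))" for t
  have "(f has_real_derivative (1 - 2 * c)) (at 0)"
    unfolding f_def by (auto intro!: derivative_eq_intros)
  from DERIV_neg_dec_right[OF this] assms obtain d where
    "d > 0" "\<And>h. h > 0 \<Longrightarrow> h < d \<Longrightarrow> f (0 + h) < f 0" by auto
  from this(1) this(2)[of "d / 2"] have "f (d / 2) < 2" by (simp add: f_def)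
  with \<open>d > 0\<close> show ?thesis by (intro that[of "d / 2"]) (auto simp: f_def)
qed

definition graph_of :: "nat \<Rightarrow> (nat set \<Rightarrow> bool) \<Rightarrow> nat graph" where
  "graph_of n y = ({..<n}, {e \<in> all_edges n. y e})"

lemma verts_graph_of [simp]: "verts (graph_of n y) = {..<n}"
  by (simp add: graph_of_def)

lemma nbrs_graph_of: "v < n \<Longrightarrow> nbrs (graph_of n y) v = {w. w < n \<and> w \<noteq> v \<and> y {v, w}}"
  by (auto simp: nbrs_def graph_of_def all_edges_def card_insert_if)

lemma finite_all_edges [simp]: "finite (all_edges n)"
  unfolding all_edges_def by (rule finite_subset[of _ "Pow {..<n}"]) auto

text \<open>A Chernoff bound: each third vertex \<open>w\<close> contributes an independent term to
  the codegree minus \<open>c\<close> times the degree, and \<rho> is the exponential moment of one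
  such term.\<close>

lemma prob_large_codegree:
  fixes c t :: real
  assumes "u < n" "v < n" "u \<noteq> v" "t > 0" "c \<ge> 0"
  defines "\<rho> \<equiv> (2 + exp (t * (1 - c)) + exp (- (t * c))) / 4"
  shows "measure_pmf.prob (Pi_pmf (all_edges n) False (\<lambda>_. bernoulli_pmf (1/2)))
      {y. c * real (card (nbrs (graph_of n y) v))
          \<le> real (card (nbrs (graph_of n y) u \<inter> nbrs (graph_of n y) v))} \<le> \<rho> ^ (n - 2)"
proof -
  let ?P = "Pi_pmf (all_edges n) False (\<lambda>_. bernoulli_pmf (1/2))"
  let ?bad = "{y. c * real (card (nbrs (graph_of n y) v))
          \<le> real (card (nbrs (graph_of n y) u \<inter> nbrs (graph_of n y) v))}"
  define W where "W = {..<n} - {u, v}"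
  define F :: "bool \<Rightarrow> bool \<Rightarrow> real"
    where "F a b = exp (t * (of_bool (a \<and> b) - c * of_bool a))" for a b
  have "\<rho> > 0" unfolding \<rho>_def by (simp add: add_pos_pos)
  have ge1: "1 \<le> (\<Prod>w\<in>W. F (y {v, w}) (y {u, w}))" if "y \<in> ?bad" for y
  proof -
    have both: "nbrs (graph_of n y) u \<inter> nbrs (graph_of n y) v = {w \<in> W. y {v, w} \<and> y {u, w}}"
      using assms(1,2) by (auto simp: nbrs_graph_of W_def)
    \<comment> \<open>Only \<open>u\<close> can be lost on the left. Ignoring the edge between
      \<open>u\<close> and \<open>v\<close> lowers the degree and leaves the codegree unchanged, so
      the bad inequality survives.\<close>
    have "card {w \<in> W. y {v, w}} \<le> card (nbrs (graph_of n y) v)"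
      using assms(2) by (intro card_mono) (auto simp: nbrs_graph_of W_def)
    then have "c * real (card {w \<in> W. y {v, w}}) \<le> c * real (card (nbrs (graph_of n y) v))"
      using assms(5) by (simp add: mult_left_mono)
    also have "\<dots> \<le> real (card {w \<in> W. y {v, w} \<and> y {u, w}})"
      using that both by simp
    finally have "0 \<le> t * (real (card {w \<in> W. y {v, w} \<and> y {u, w}}) - c * real (card {w \<in> W. y {v, w}}))"
      using assms(4) by simp
    also have "\<dots> = (\<Sum>w\<in>W. t * (of_bool (y {v, w} \<and> y {u, w}) - c * of_bool (y {v, w})))"
      by (simp add: W_def sum_distrib_left[symmetric] sum_subtractf sum_of_bool_eq Int_def del: of_bool_conj)
    finally show ?thesis
      unfolding F_def by (simp add: exp_sum[symmetric] W_def)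
  qed
  have average: "(\<integral>\<^sup>+b. ennreal (f b) \<partial>bernoulli_pmf (1/2)) = ennreal ((f True + f False) / 2)"
    if "\<And>b. f b \<ge> 0" for f :: "bool \<Rightarrow> real"
    by (subst nn_integral_eq_integral)
      (auto intro!: integrable_measure_pmf_finite simp: that add_divide_distrib)
  have "emeasure ?P ?bad = (\<integral>\<^sup>+y. indicator ?bad y \<partial>?P)" by simp
  \<comment> \<open>Markov's inequality in the form that the indicator is at most the
    exponential.\<close>
  also have "\<dots> \<le> (\<integral>\<^sup>+y. (\<Prod>w\<in>W. ennreal (F (y {v, w}) (y {u, w}))) \<partial>?P)"
    using ge1 by (intro nn_integral_mono)
      (auto simp: indicator_def prod_ennreal F_def simp flip: ennreal_1 intro!: ennreal_leI)
  also have "\<dots> = (\<integral>\<^sup>+a. \<integral>\<^sup>+b. ennreal (F a b) \<partial>bernoulli_pmf (1/2) \<partial>bernoulli_pmf (1/2)) ^ card W"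
    using assms(1-3)
    by (intro nn_integral_Pi_pmf_pairs)
      (auto simp: W_def all_edges_def card_insert_if inj_on_def doubleton_eq_iff)
  \<comment> \<open>Of the four equally likely pairs, the two with \<open>a\<close> false contribute
    1 each.\<close>
  also have "(\<integral>\<^sup>+a. \<integral>\<^sup>+b. ennreal (F a b) \<partial>bernoulli_pmf (1/2) \<partial>bernoulli_pmf (1/2)) = ennreal \<rho>"
    by (simp add: average F_def \<rho>_def field_simps del: nn_integral_bernoulli_pmf)
  also have "card W = n - 2"
    using assms(1-3) by (simp add: W_def card_Diff_subset)
  finally have "ennreal (measure_pmf.prob ?P ?bad) \<le> ennreal (\<rho> ^ (n - 2))"
    using \<open>\<rho> > 0\<close> by (simp add: measure_pmf.emeasure_eq_measure ennreal_power)
  then show ?thesis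
    using \<open>\<rho> > 0\<close> by (simp add: ennreal_le_iff)
qed

text \<open>A union bound over the ordered pairs of distinct vertices, of which there are at most
  \<open>n ^ 2\<close>.\<close>

lemma prob_not_sparse_codegrees:
  fixes c t :: real
  assumes "t > 0" "c \<ge> 0"
  defines "\<rho> \<equiv> (2 + exp (t * (1 - c)) + exp (- (t * c))) / 4"
  shows "measure_pmf.prob (random_graph n (1/2)) {G. \<not> sparse_codegrees c G}
      \<le> real n ^ 2 * \<rho> ^ (n - 2)"
proof -
  let ?P = "Pi_pmf (all_edges n) False (\<lambda>_. bernoulli_pmf (1/2))"
  let ?bad = "\<lambda>(u, v). {y. c * real (card (nbrs (graph_of n y) v))
          \<le> real (card (nbrs (graph_of n y) u \<inter> nbrs (graph_of n y) v))}"
  let ?I = "{(u, v). u < n \<and> v < n \<and> u \<noteq> v}"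
  have sub: "?I \<subseteq> {..<n} \<times> {..<n}" by auto
  then have fin: "finite ?I" by (rule finite_subset) simp
  have "\<rho> > 0" unfolding \<rho>_def by (simp add: add_pos_pos)
  have "random_graph n (1/2) = map_pmf (graph_of n) ?P"
    by (simp add: random_graph_def graph_of_def[abs_def])
  then have "measure_pmf.prob (random_graph n (1/2)) {G. \<not> sparse_codegrees c G}
      = measure_pmf.prob ?P {y. \<not> sparse_codegrees c (graph_of n y)}"
    by (simp add: vimage_def)
  also have "\<dots> \<le> measure_pmf.prob ?P (\<Union>i\<in>?I. ?bad i)"
    by (intro measure_pmf.finite_measure_mono) (auto simp: sparse_codegrees_def not_less)
  also have "\<dots> \<le> (\<Sum>i\<in>?I. measure_pmf.prob ?P (?bad i))"
    using fin by (intro measure_pmf.finite_measure_subadditive_finite) auto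
  also have "\<dots> \<le> (\<Sum>i\<in>?I. \<rho> ^ (n - 2))"
    using prob_large_codegree[OF _ _ _ assms(1,2)] unfolding \<rho>_def
    by (intro sum_mono) auto
  also have "\<dots> = real (card ?I) * \<rho> ^ (n - 2)" by simp
  also have "\<dots> \<le> real n ^ 2 * \<rho> ^ (n - 2)"
  proof (rule mult_right_mono)
    show "real (card ?I) \<le> real n ^ 2"
      using card_mono[OF _ sub] by (simp add: power2_eq_square flip: of_nat_mult)
  qed (use \<open>\<rho> > 0\<close> in simp)
  finally show ?thesis .
qed

theorem theorem3p2:
  fixes \<delta> :: real
  assumes "\<delta> > 0"
  shows "(\<lambda>n. measure_pmf.prob (random_graph n (1/2))
            {G. ereal_of_enat (warmth G) \<le> ereal ((1 + \<delta>) * log 2 (real n) + 1)})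
          \<longlonglongrightarrow> 1"
proof -
  define c :: real where "c = 2 powr (- 1 / (1 + \<delta> / 2))"
  \<comment> \<open>Positivity of \<delta> enters here: \<open>c\<close> must exceed 1/2, the
    typical ratio of codegree to degree.\<close>
  have "2 powr (- 1) < c"
    unfolding c_def using assms by (intro powr_less_mono) (auto simp: field_simps)
  then have c: "c > 1/2" by (simp add: powr_minus_divide)
  from exp_average_less_1[OF this] obtain t where
    t: "t > 0" "(2 + exp (t * (1 - c)) + exp (- (t * c))) / 4 < 1" .
  define \<rho> where "\<rho> = (2 + exp (t * (1 - c)) + exp (- (t * c))) / 4"
  have \<rho>: "0 < \<rho>" "\<rho> < 1" using t(2) by (auto simp: \<rho>_def add_pos_pos)
  let ?p = "\<lambda>n. measure_pmf.prob (random_graph n (1/2))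
            {G. ereal_of_enat (warmth G) \<le> ereal ((1 + \<delta>) * log 2 (real n) + 1)}"
  have "\<forall>\<^sub>F n in sequentially. \<delta> / 2 * log 2 (real n) \<ge> 1"
    using assms by real_asymp
  then have lower: "\<forall>\<^sub>F n in sequentially. 1 - real n ^ 2 * \<rho> ^ (n - 2) \<le> ?p n"
    using eventually_ge_at_top[of 2]
  proof eventually_elim
    case (elim n)
    have "1 - real n ^ 2 * \<rho> ^ (n - 2)
        \<le> 1 - measure_pmf.prob (random_graph n (1/2)) {G. \<not> sparse_codegrees c G}"
      using prob_not_sparse_codegrees[OF t(1), of c n] c by (simp add: \<rho>_def)
    also have "\<dots> = measure_pmf.prob (random_graph n (1/2)) {G. sparse_codegrees c G}"
      by (subst measure_pmf.prob_compl[symmetric]) (auto intro!: arg_cong2[where f = measure])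
    also have "\<dots> \<le> ?p n"
    \<comment> \<open>The inclusion of events is needed only on the support, where the vertex set is
      known to be \<open>{..<n}\<close>.\<close>
    proof (rule measure_pmf.finite_measure_mono_AE)
      have "ereal_of_enat (warmth G) \<le> ereal ((1 + \<delta>) * log 2 (real n) + 1)"
        if "G \<in> set_pmf (random_graph n (1/2))" "sparse_codegrees c G" for G
      proof -
        have "verts G = {..<n}" using that(1) by (auto simp: random_graph_def)
        then show ?thesis
          using warmth_le_if_sparse_codegrees[OF assms, of G] elim that(2) by (simp add: c_def)
      qed
      then show "AE G in random_graph n (1/2). G \<in> {G. sparse_codegrees c G} \<longrightarrow>
        G \<in> {G. ereal_of_enat (warmth G) \<le> ereal ((1 + \<delta>) * log 2 (real n) + 1)}"
        by (simp add: AE_measure_pmf_iff)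
    qed simp
    finally show ?case .
  qed
  \<comment> \<open>The geometric decay beats the quadratic number of pairs.\<close>
  have "(\<lambda>n. 1 - real n ^ 2 * \<rho> ^ (n - 2)) \<longlonglongrightarrow> 1"
    using \<rho> by real_asymp
  from tendsto_sandwich[OF lower _ this tendsto_const] show ?thesis by simp
qed

end
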